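(* In the GS model over the technology set $\mathcal T$ with the GS range directions (for some fixed $\theta_{\min}\in[0,1)\cap\mathcal D$ common to all units), the following are equivalent. (i) All units in $\mathcal T$ are projected onto the strongly efficient frontier, i.e. $\boldsymbol\phi_o(\theta_o^* )\in\partial^S\mathcal T$ for each $(\mathbf x_o,\mathbf y_o)\in\mathcal T$. (ii) $\mathcal T$ is an ideal technology set.
   Context: Data and technology. $\mathbf X=(x_{ij})\in\mathbb R^{m\times n}$ and $\mathbf Y=(y_{rj})\in\mathbb R^{s\times n}$ are input and output data matrices (no sign restriction). With $\mathbf e$ the vector of ones, the technology set is $\mathcal T=\{(\mathbf x,\mathbf y)\in\mathbb R^m\times\mathbb R^s:\ \mathbf X\boldsymbol\lambda\le\mathbf x,\ \mathbf Y\boldsymbol\lambda\ge\mathbf y \text{ for some } \boldsymbol\lambda\ge 0,\ \mathbf e^\top\boldsymbol\lambda=1\}$. Elements of $\mathcal T$ are called units. The ideal point of $\mathcal T$ is $(\mathbf x^{\min},\mathbf y^{\max})$ with $x_i^{\min}=\min_j x_{ij}$, $y_r^{\max}=\max_j y_{rj}$; it may or may not belong to $\mathcal T$. Efficiency. A point $(\mathbf x_o,\mathbf y_o)$ dominates a distinct point $(\mathbf x_p,\mathbf y_p)$ if $\mathbf x_o\le\mathbf x_p$, $\mathbf y_o\ge\mathbf y_p$ componentwise; it strictly dominates it if $\mathbf x_o<\mathbf x_p$, $\mathbf y_o>\mathbf y_p$ in every component. A unit of $\mathcal T$ is strongly efficient if no other unit of $\mathcal T$ dominates it, and weakly efficient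 if no unit of $\mathcal T$ strictly dominates it. The boundary $\partial\mathcal T$ is the set of weakly efficient units; $\partial^S\mathcal T$ (strongly efficient frontier) is the set of strongly efficient units and $\partial^W\mathcal T=\partial\mathcal T\setminus\partial^S\mathcal T$. Ideal technology. $\mathcal T$ is an ideal technology set if every $(\mathbf x,\mathbf y)\in\partial^W\mathcal T$ has at least one component in common with the ideal point, i.e. $x_i=x_i^{\min}$ for some $i\in\{1,\dots,m\}$ or $y_r=y_r^{\max}$ for some $r\in\{1,\dots,s\}$. GS model. The real functions $\psi^x,\psi^y$ satisfy: (A1) $\operatorname{dom}\psi^x=(a^x,\infty)$, $\operatorname{dom}\psi^y=(a^y,\infty)$ with $a^x,a^y\in\{-\infty,0\}$; (A2) $\psi^x$ is smooth, concave, (strictly) increasing and $\psi^y$ is smooth, convex, (strictly) decreasing; (A3) $\psi^x(1)=\psi^y(1)=1$; (A4) $\operatorname{im}\psi^x=(b^x,\infty)$ with $b^x\in\{-\infty,0\}$ ($b^x=-\infty$ if the output directions $\mathbf g_o^y$ are zero for all units) and $\operatorname{im}\psi^y=(b^y,\infty)$ with $b^y\in\{-\infty,0\}$. Let $\mathcal D=\operatorname{dom}\psi^x\cap\operatorname{dom}\psi^y$. For a unit $(\mathbf x_o,\mathbf y_o)$ with direction $\mathbf g_o=(\mathbf g_o^x,\mathbf g_o^y)\ge0$, $\mathbf g_o\neq0$, its path is $\boldsymbol\phi_o(\theta)=(\boldsymbol\phi_o^x(\theta),\boldsymbol\phi_o^y(\theta))$, $\theta\in\mathcal D$, with $\boldsymbol\phi_o^x(\theta)=\mathbf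 x_o+(\psi^x(\theta)-1)\mathbf g_o^x$, $\boldsymbol\phi_o^y(\theta)=\mathbf y_o+(\psi^y(\theta)-1)\mathbf g_o^y$. The programme $(GS)_o$ is: minimise $\theta$ over $(\boldsymbol\lambda,\theta)$, $\theta\in\mathcal D$, subject to $\mathbf X\boldsymbol\lambda\le\boldsymbol\phi_o^x(\theta)$, $\mathbf Y\boldsymbol\lambda\ge\boldsymbol\phi_o^y(\theta)$, $\mathbf e^\top\boldsymbol\lambda=1$, $\boldsymbol\lambda\ge0$. It is part of the setting that the minimum is attained; its value $\theta_o^*\le1$ is the efficiency score and $\boldsymbol\phi_o(\theta_o^* )\in\partial\mathcal T$ is the projection of the unit. GS range directions. For fixed $\theta_{\min}\in[0,1)\cap\mathcal D$, the GS range direction of $(\mathbf x_o,\mathbf y_o)\in\mathcal T$ is $\mathbf g_o^x=\dfrac{\mathbf x_o-\mathbf x^{\min}}{1-\psi^x(\theta_{\min})}$, $\mathbf g_o^y=\dfrac{\mathbf y^{\max}-\mathbf y_o}{\psi^y(\theta_{\min})-1}$. If the ideal point itself belongs to $\mathcal T$, its GS range direction vanishes; for this unit (the only strongly efficient unit in that case) one sets $\theta_o^*=1$ by convention, its projection being itself. *)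

theory Defs
  imports "HOL-Analysis.Analysis"
begin

text \<open>A point \<open>(x, y)\<close> of input-output space is a pair in \<open>(real^'m) \<times> (real^'s)\<close>. On vectors
  \<open>\<le>\<close> is the componentwise order; the library's \<open><\<close> on vectors is not componentwise strict, so
  strict inequalities are written out by components.\<close>

definition technology :: "real^'n^'m \<Rightarrow> real^'n^'s \<Rightarrow> ((real^'m) \<times> (real^'s)) set" where
  "technology X Y = {(x, y). \<exists>l :: real^'n.
     X *v l \<le> x \<and> y \<le> Y *v l \<and> 0 \<le> l \<and> (\<Sum>j\<in>UNIV. l $ j) = 1}"

definition ideal_point :: "real^'n^'m \<Rightarrow> real^'n^'s \<Rightarrow> (real^'m) \<times> (real^'s)" where
  "ideal_point X Y = ((\<chi> i. MIN j. X $ i $ j), (\<chi> r. MAX j. Y $ r $ j))"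

definition dominates :: "(real^'m) \<times> (real^'s) \<Rightarrow> (real^'m) \<times> (real^'s) \<Rightarrow> bool" where
  "dominates u v \<longleftrightarrow> u \<noteq> v \<and> fst u \<le> fst v \<and> snd v \<le> snd u"

definition strictly_dominates :: "(real^'m) \<times> (real^'s) \<Rightarrow> (real^'m) \<times> (real^'s) \<Rightarrow> bool" where
  "strictly_dominates u v \<longleftrightarrow>
     (\<forall>i. fst u $ i < fst v $ i) \<and> (\<forall>r. snd v $ r < snd u $ r)"

definition weakly_efficient :: "((real^'m) \<times> (real^'s)) set \<Rightarrow> ((real^'m) \<times> (real^'s)) set" where
  "weakly_efficient T = {u \<in> T. \<not> (\<exists>v\<in>T. strictly_dominates v u)}"

definition strongly_efficient :: "((real^'m) \<times> (real^'s)) set \<Rightarrow> ((real^'m) \<times> (real^'s)) set" where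
  "strongly_efficient T = {u \<in> T. \<not> (\<exists>v\<in>T. dominates v u)}"

definition ideal_technology :: "real^'n^'m \<Rightarrow> real^'n^'s \<Rightarrow> bool" where
  "ideal_technology X Y \<longleftrightarrow>
     (\<forall>u \<in> weakly_efficient (technology X Y) - strongly_efficient (technology X Y).
        (\<exists>i. fst u $ i = fst (ideal_point X Y) $ i) \<or>
        (\<exists>r. snd u $ r = snd (ideal_point X Y) $ r))"

text \<open>The open half-line from \<open>a\<close> to infinity, where \<open>a\<close> may be \<open>-\<infinity>\<close>.\<close>

definition ray :: "ereal \<Rightarrow> real set" where
  "ray a = {t. a < ereal t}"

definition gs_path :: "(real \<Rightarrow> real) \<Rightarrow> (real \<Rightarrow> real) \<Rightarrow> (real^'m) \<times> (real^'s) \<Rightarrow>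
    (real^'m) \<times> (real^'s) \<Rightarrow> real \<Rightarrow> (real^'m) \<times> (real^'s)" where
  "gs_path \<psi>x \<psi>y g u \<theta> =
     (fst u + (\<psi>x \<theta> - 1) *\<^sub>R fst g, snd u + (\<psi>y \<theta> - 1) *\<^sub>R snd g)"

definition gs_feasible :: "real^'n^'m \<Rightarrow> real^'n^'s \<Rightarrow> (real \<Rightarrow> real) \<Rightarrow> (real \<Rightarrow> real) \<Rightarrow> real set \<Rightarrow>
    (real^'m) \<times> (real^'s) \<Rightarrow> (real^'m) \<times> (real^'s) \<Rightarrow> real^'n \<Rightarrow> real \<Rightarrow> bool" where
  "gs_feasible X Y \<psi>x \<psi>y D g u l \<theta> \<longleftrightarrow> \<theta> \<in> D \<and>
     X *v l \<le> fst (gs_path \<psi>x \<psi>y g u \<theta>) \<and> snd (gs_path \<psi>x \<psi>y g u \<theta>) \<le> Y *v l \<and>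
     (\<Sum>j\<in>UNIV. l $ j) = 1 \<and> 0 \<le> l"

definition gs_value :: "real^'n^'m \<Rightarrow> real^'n^'s \<Rightarrow> (real \<Rightarrow> real) \<Rightarrow> (real \<Rightarrow> real) \<Rightarrow> real set \<Rightarrow>
    (real^'m) \<times> (real^'s) \<Rightarrow> (real^'m) \<times> (real^'s) \<Rightarrow> real" where
  "gs_value X Y \<psi>x \<psi>y D g u = (LEAST \<theta>. \<exists>l. gs_feasible X Y \<psi>x \<psi>y D g u l \<theta>)"

definition range_direction :: "real^'n^'m \<Rightarrow> real^'n^'s \<Rightarrow> (real \<Rightarrow> real) \<Rightarrow> (real \<Rightarrow> real) \<Rightarrow> real \<Rightarrow>
    (real^'m) \<times> (real^'s) \<Rightarrow> (real^'m) \<times> (real^'s)" where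
  "range_direction X Y \<psi>x \<psi>y \<theta>min u =
     ((1 / (1 - \<psi>x \<theta>min)) *\<^sub>R (fst u - fst (ideal_point X Y)),
      (1 / (\<psi>y \<theta>min - 1)) *\<^sub>R (snd (ideal_point X Y) - snd u))"

text \<open>At the ideal point the range direction vanishes, every parameter is feasible, and the
  score is \<open>1\<close> by convention. For every other unit the minimum is attained; see
  \<open>range_minimum_attained\<close> below.\<close>

definition range_score :: "real^'n^'m \<Rightarrow> real^'n^'s \<Rightarrow> (real \<Rightarrow> real) \<Rightarrow> (real \<Rightarrow> real) \<Rightarrow> real set \<Rightarrow>
    real \<Rightarrow> (real^'m) \<times> (real^'s) \<Rightarrow> real" where
  "range_score X Y \<psi>x \<psi>y D \<theta>min u =
     (if u = ideal_point X Y then 1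
      else gs_value X Y \<psi>x \<psi>y D (range_direction X Y \<psi>x \<psi>y \<theta>min u) u)"

definition range_projection :: "real^'n^'m \<Rightarrow> real^'n^'s \<Rightarrow> (real \<Rightarrow> real) \<Rightarrow> (real \<Rightarrow> real) \<Rightarrow>
    real set \<Rightarrow> real \<Rightarrow> (real^'m) \<times> (real^'s) \<Rightarrow> (real^'m) \<times> (real^'s)" where
  "range_projection X Y \<psi>x \<psi>y D \<theta>min u =
     gs_path \<psi>x \<psi>y (range_direction X Y \<psi>x \<psi>y \<theta>min u) u
       (range_score X Y \<psi>x \<psi>y D \<theta>min u)"

lemma ideal_point_bounds:
  fixes X :: "real^'n^'m" and Y :: "real^'n^'s"
  assumes l: "0 \<le> l" "(\<Sum>j\<in>UNIV. l $ j) = 1"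
  shows "fst (ideal_point X Y) $ i \<le> (X *v l) $ i"
    and "(Y *v l) $ r \<le> snd (ideal_point X Y) $ r"
proof -
  have l0: "0 \<le> l $ j" for j
    using l(1) by (simp add: less_eq_vec_def)
  have "(MIN j. X $ i $ j) = (\<Sum>j\<in>UNIV. (MIN j. X $ i $ j) * l $ j)"
    using l(2) by (simp add: sum_distrib_left[symmetric])
  also have "\<dots> \<le> (\<Sum>j\<in>UNIV. X $ i $ j * l $ j)"
    by (intro sum_mono mult_right_mono l0) simp
  finally show "fst (ideal_point X Y) $ i \<le> (X *v l) $ i"
    by (simp add: ideal_point_def matrix_vector_mult_def)
  have "(\<Sum>j\<in>UNIV. Y $ r $ j * l $ j) \<le> (\<Sum>j\<in>UNIV. (MAX j. Y $ r $ j) * l $ j)"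
    by (intro sum_mono mult_right_mono l0) simp
  also have "\<dots> = (MAX j. Y $ r $ j)"
    using l(2) by (simp add: sum_distrib_left[symmetric])
  finally show "(Y *v l) $ r \<le> snd (ideal_point X Y) $ r"
    by (simp add: ideal_point_def matrix_vector_mult_def)
qed

lemma compact_weights: "compact {l :: real^'n. 0 \<le> l \<and> (\<Sum>j\<in>UNIV. l $ j) = 1}"
proof -
  have "{l :: real^'n. 0 \<le> l \<and> (\<Sum>j\<in>UNIV. l $ j) = 1}
      = cbox 0 (\<chi> j. 1) \<inter> {l. (\<Sum>j\<in>UNIV. l $ j) = 1}"
  proof -
    have "l $ j \<le> 1" if "\<forall>j. 0 \<le> l $ j" "(\<Sum>j\<in>UNIV. l $ j) = 1" for l :: "real^'n" and j
      using member_le_sum[of j UNIV "\<lambda>j. l $ j"] that by simp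
    then show ?thesis
      by (auto simp: mem_box_cart less_eq_vec_def)
  qed
  moreover have "closed {l :: real^'n. (\<Sum>j\<in>UNIV. l $ j) = 1}"
    by (intro closed_Collect_eq continuous_intros)
  ultimately show ?thesis
    by (simp add: compact_Int_closed)
qed

lemma range_minimum_attained:
  fixes X :: "real^'n^'m" and Y :: "real^'n^'s"
  assumes contx: "continuous_on (ray ax) \<psi>x" and conty: "continuous_on (ray ay) \<psi>y"
    and mono: "strict_mono_on (ray ax) \<psi>x" "strict_antimono_on (ray ay) \<psi>y"
    and one: "\<psi>x 1 = 1" "\<psi>y 1 = 1"
    and \<theta>min: "\<theta>min \<in> {0..<1} \<inter> (ray ax \<inter> ray ay)"
    and u: "u \<in> technology X Y" "u \<noteq> ideal_point X Y"
  defines "feas \<equiv> gs_feasible X Y \<psi>x \<psi>y (ray ax \<inter> ray ay) (range_direction X Y \<psi>x \<psi>y \<theta>min u) u"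
  shows "\<exists>\<theta>\<in>{\<theta>min..1}. (\<exists>l. feas l \<theta>) \<and> (\<forall>\<theta>' l'. feas l' \<theta>' \<longrightarrow> \<theta> \<le> \<theta>')"
proof -
  let ?g = "range_direction X Y \<psi>x \<psi>y \<theta>min u"
  let ?I = "ideal_point X Y"
  let ?K = "{l :: real^'n. 0 \<le> l \<and> (\<Sum>j\<in>UNIV. l $ j) = 1}"
  have ray: "t \<in> ray ax" "t \<in> ray ay" if "\<theta>min \<le> t" for t
  proof -
    have "ereal \<theta>min \<le> ereal t" using that by simp
    then show "t \<in> ray ax" "t \<in> ray ay"
      using \<theta>min unfolding ray_def by (auto intro: less_le_trans)
  qed
  have lt: "\<theta>min < 1" using \<theta>min by simp
  have dx: "0 < 1 - \<psi>x \<theta>min" and dy: "0 < \<psi>y \<theta>min - 1"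
    using strict_mono_onD[OF mono(1), of \<theta>min 1] monotone_onD[OF mono(2), of \<theta>min 1]
      ray lt one by auto
  obtain l0 where l0: "X *v l0 \<le> fst u" "snd u \<le> Y *v l0" "0 \<le> l0" "(\<Sum>j\<in>UNIV. l0 $ j) = 1"
    using u(1) by (auto simp: technology_def)
  have ux: "fst ?I $ i \<le> fst u $ i" for i
    using ideal_point_bounds(1)[OF l0(3,4), of X Y i] l0(1)[unfolded less_eq_vec_def, rule_format, of i]
    by linarith
  have uy: "snd u $ r \<le> snd ?I $ r" for r
    using ideal_point_bounds(2)[OF l0(3,4), of Y r X] l0(2)[unfolded less_eq_vec_def, rule_format, of r]
    by linarith
  have low: "\<theta>min \<le> t" if f: "feas l t" for l t
  proof (rule ccontr)
    assume "\<not> \<theta>min \<le> t"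
    then have t: "t < \<theta>min" by simp
    have lK: "0 \<le> l" "(\<Sum>j\<in>UNIV. l $ j) = 1" and tD: "t \<in> ray ax" "t \<in> ray ay"
      and fx: "X *v l \<le> fst (gs_path \<psi>x \<psi>y ?g u t)" and fy: "snd (gs_path \<psi>x \<psi>y ?g u t) \<le> Y *v l"
      using f unfolding feas_def gs_feasible_def by auto
    have px: "\<psi>x t < \<psi>x \<theta>min" and py: "\<psi>y \<theta>min < \<psi>y t"
      using strict_mono_onD[OF mono(1), of t \<theta>min] monotone_onD[OF mono(2), of t \<theta>min]
        tD t ray by auto
    consider i where "fst ?I $ i < fst u $ i" | r where "snd u $ r < snd ?I $ r"
      using u(2) ux uy by (metis order_less_le prod_eqI vec_eq_iff)
    then show False
    proof cases
      case 1
      let ?k = "(\<psi>x t - 1) / (1 - \<psi>x \<theta>min)"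
      have "?k < -1"
        using px dx by (simp add: field_simps)
      then have "?k * (fst u $ i - fst ?I $ i) < -1 * (fst u $ i - fst ?I $ i)"
        using 1 by (intro mult_strict_right_mono) auto
      moreover have "(X *v l) $ i \<le> fst u $ i + ?k * (fst u $ i - fst ?I $ i)"
        using fx[unfolded less_eq_vec_def, rule_format, of i]
        by (simp add: gs_path_def range_direction_def)
      ultimately show False
        using ideal_point_bounds(1)[OF lK, of X Y i]
        by (smt (verit))
    next
      case 2
      let ?k = "(\<psi>y t - 1) / (\<psi>y \<theta>min - 1)"
      have "1 < ?k"
        using py dy by (simp add: field_simps)
      then have "1 * (snd ?I $ r - snd u $ r) < ?k * (snd ?I $ r - snd u $ r)"
        using 2 by (intro mult_strict_right_mono) auto
      moreover have "snd u $ r + ?k * (snd ?I $ r - snd u $ r) \<le> (Y *v l) $ r"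
        using fy[unfolded less_eq_vec_def, rule_format, of r]
        by (simp add: gs_path_def range_direction_def)
      ultimately show False
        using ideal_point_bounds(2)[OF lK, of Y r X]
        by (smt (verit))
    qed
  qed
  define C where "C = ?K \<times> {\<theta>min..1}"
  have C: "compact C"
    unfolding C_def by (intro compact_Times compact_weights compact_Icc)
  have cx: "continuous_on C (\<lambda>z. \<psi>x (snd z))"
    by (rule continuous_on_compose2[OF contx continuous_on_snd[OF continuous_on_id]])
      (auto simp: C_def ray)
  have cy: "continuous_on C (\<lambda>z. \<psi>y (snd z))"
    by (rule continuous_on_compose2[OF conty continuous_on_snd[OF continuous_on_id]])
      (auto simp: C_def ray)
  define S where "S = C \<inter> (\<Inter>i. {z \<in> C. (X *v fst z) $ i \<le> fst u $ i + (\<psi>x (snd z) - 1) * fst ?g $ i})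
     \<inter> (\<Inter>r. {z \<in> C. snd u $ r + (\<psi>y (snd z) - 1) * snd ?g $ r \<le> (Y *v fst z) $ r})"
  have S: "(l, t) \<in> S \<longleftrightarrow> t \<in> {\<theta>min..1} \<and> feas l t" for l t
    unfolding S_def C_def feas_def gs_feasible_def gs_path_def
    using ray by (auto simp: less_eq_vec_def)
  have mv: "continuous_on C (\<lambda>z. (A *v fst z) $ i)" for A :: "real^'n^'k" and i
    unfolding matrix_vector_mult_def vec_lambda_beta by (intro continuous_intros)
  have "compact S"
    unfolding S_def
    by (intro compact_Int_closed C closed_INT ballI continuous_on_closed_Collect_le
        mv cx cy continuous_intros compact_imp_closed)
  moreover have "(l0, 1) \<in> S"
    using l0 lt ray[of 1] one unfolding S by (auto simp: feas_def gs_feasible_def gs_path_def)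
  ultimately obtain z where z: "z \<in> S" "\<forall>w\<in>S. snd z \<le> snd w"
    using continuous_attains_inf[of S snd] continuous_on_snd[OF continuous_on_id] by blast
  obtain l t where zz: "z = (l, t)" by (cases z)
  have t: "t \<in> {\<theta>min..1}" "feas l t" using z(1) zz S by auto
  moreover have "t \<le> t'" if "feas l' t'" for l' t'
  proof (cases "t' \<le> 1")
    case True
    then have "(l', t') \<in> S" using low[OF that] that S by simp
    then show ?thesis using z(2) zz by fastforce
  qed (use t in auto)
  ultimately show ?thesis by blast
qed

end

theory Submission
  imports Defs
begin

text \<open>
  A unit without components in common with the ideal point \<open>I\<close> moves along its path in every
  component, so a weakly efficient one is its own projection; hence (i) implies (ii). Conversely,
  let \<open>p \<noteq> I\<close> be a projection. No point of the segment from \<open>p\<close> to \<open>I\<close> other than \<open>p\<close> is a unit.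
  The point \<open>p\<close> may share components with \<open>I\<close>, so worsen it by \<open>1/n\<close> in every component
  and move it straight towards \<open>I\<close> until it leaves the technology. The exit point is weakly efficient
  and shares no component with \<open>I\<close>, so it is strongly efficient in an ideal technology. The exit
  points accumulate at \<open>p\<close>, and the strongly efficient frontier is closed because the technology is
  polyhedral.
\<close>

section \<open>Units, the componentwise order and the ideal point\<close>

lemma technology_ideal_bounds:
  assumes "u \<in> technology X Y"
  shows "fst (ideal_point X Y) \<le> fst u" and "snd u \<le> snd (ideal_point X Y)"
proof -
  obtain l where l: "X *v l \<le> fst u" "snd u \<le> Y *v l" "0 \<le> l" "(\<Sum>j\<in>UNIV. l $ j) = 1"
    using assms by (auto simp: technology_def)
  have "fst (ideal_point X Y) \<le> X *v l" "Y *v l \<le> snd (ideal_point X Y)"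
    unfolding less_eq_vec_def
    using ideal_point_bounds(1)[OF l(3,4), of X Y] ideal_point_bounds(2)[OF l(3,4), of Y _ X] by auto
  then show "fst (ideal_point X Y) \<le> fst u" "snd u \<le> snd (ideal_point X Y)"
    using l by (auto intro: order_trans)
qed

lemma technology_free_disposal:
  assumes "u \<in> technology X Y" "fst u \<le> fst v" "snd v \<le> snd u"
  shows "v \<in> technology X Y"
  using assms unfolding technology_def by (auto simp: case_prod_beta) (meson order_trans)

text \<open>The ideal point bounds every unit in all components, so by antisymmetry a unit that is
  at least as good can only be the ideal point itself.\<close>

lemma ideal_point_strongly_efficient:
  assumes "ideal_point X Y \<in> technology X Y"
  shows "ideal_point X Y \<in> strongly_efficient (technology X Y)"
proof -
  have "v = ideal_point X Y" if "v \<in> technology X Y" "fst v \<le> fst (ideal_point X Y)"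
    "snd (ideal_point X Y) \<le> snd v" for v
    using technology_ideal_bounds[OF that(1)] that by (intro prod_eqI order_antisym)
  with assms show ?thesis
    by (auto simp: strongly_efficient_def dominates_def)
qed

text \<open>The weights that witness membership define a unit without slack that is at least as good
  as \<open>u\<close>. Strong efficiency forces the two to coincide.\<close>

lemma strongly_efficient_imp_combination:
  assumes "u \<in> strongly_efficient (technology X Y)"
  obtains l where "0 \<le> l" "(\<Sum>j\<in>UNIV. l $ j) = 1" "u = (X *v l, Y *v l)"
proof -
  obtain l where l: "X *v l \<le> fst u" "snd u \<le> Y *v l" "0 \<le> l" "(\<Sum>j\<in>UNIV. l $ j) = 1"
    using assms by (auto simp: technology_def strongly_efficient_def)
  then have "(X *v l, Y *v l) \<in> technology X Y"
    by (auto simp: technology_def)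
  with assms l have "(X *v l, Y *v l) = u"
    by (auto simp: strongly_efficient_def dominates_def)
  with l that show ?thesis by blast
qed

section \<open>Closedness of the technology and of its strongly efficient frontier\<close>

lemma tendsto_matrix_vector_mult:
  fixes A :: "real^'n^'m"
  assumes "(f \<longlongrightarrow> l) F"
  shows "((\<lambda>k. A *v f k) \<longlongrightarrow> A *v l) F"
  by (rule bounded_linear.tendsto[OF matrix_vector_mul_bounded_linear assms])

text \<open>Compactness of the weight simplex in the form that both closedness proofs use: once the
  weights converge, relations between units and weights pass to the limit.\<close>

lemma weights_convergent_subsequence:
  fixes l :: "nat \<Rightarrow> real^'n"
  assumes "\<And>n. 0 \<le> l n" "\<And>n. (\<Sum>j\<in>UNIV. l n $ j) = 1"
  obtains m r where "0 \<le> m" "(\<Sum>j\<in>UNIV. m $ j) = 1" "strict_mono (r :: nat \<Rightarrow> nat)"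
    "(\<lambda>n. l (r n)) \<longlonglongrightarrow> m"
proof -
  have "\<forall>n. l n \<in> {l. 0 \<le> l \<and> (\<Sum>j\<in>UNIV. l $ j) = 1}"
    using assms by simp
  from compact_weights[unfolded compact_def, THEN spec, THEN mp, OF this] show ?thesis
  proof (elim bexE exE conjE)
    fix m and r :: "nat \<Rightarrow> nat"
    assume "m \<in> {l. 0 \<le> l \<and> (\<Sum>j\<in>UNIV. l $ j) = 1}" "strict_mono r" "(l \<circ> r) \<longlonglongrightarrow> m"
    then show ?thesis
      by (intro that[of m r]) (simp_all add: o_def)
  qed
qed

text \<open>Along a subsequence the witnessing weights converge within the simplex, and the weak
  inequalities survive the limit.\<close>

lemma closed_technology: "closed (technology X Y)"
  unfolding closed_sequential_limits
proof (intro allI impI, elim conjE)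
  fix u p
  assume u: "\<forall>n. u n \<in> technology X Y" and lim: "u \<longlonglongrightarrow> p"
  have "\<forall>n. \<exists>l. X *v l \<le> fst (u n) \<and> snd (u n) \<le> Y *v l \<and> 0 \<le> l \<and> (\<Sum>j\<in>UNIV. l $ j) = 1"
    using u by (auto simp: technology_def case_prod_beta)
  from choice[OF this] obtain l where "\<forall>n. X *v l n \<le> fst (u n) \<and> snd (u n) \<le> Y *v l n
      \<and> 0 \<le> l n \<and> (\<Sum>j\<in>UNIV. l n $ j) = 1"
    by (rule exE)
  then have l: "X *v l n \<le> fst (u n)" "snd (u n) \<le> Y *v l n" "0 \<le> l n" "(\<Sum>j\<in>UNIV. l n $ j) = 1" for n
    by simp_all
  obtain m r where m: "0 \<le> m" "(\<Sum>j\<in>UNIV. m $ j) = 1"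
    and r: "strict_mono (r :: nat \<Rightarrow> nat)" and lr: "(\<lambda>n. l (r n)) \<longlonglongrightarrow> m"
    using weights_convergent_subsequence[OF l(3,4)] .
  have ur: "(\<lambda>n. u (r n)) \<longlonglongrightarrow> p"
    using LIMSEQ_subseq_LIMSEQ[OF lim r] by (simp add: o_def)
  have "X *v m \<le> fst p"
    unfolding less_eq_vec_def
  proof
    fix i
    show "(X *v m) $ i \<le> fst p $ i"
      by (rule LIMSEQ_le[OF tendsto_vec_nth[OF tendsto_matrix_vector_mult[OF lr]]
            tendsto_vec_nth[OF tendsto_fst[OF ur]]])
        (use l(1) in \<open>auto simp: less_eq_vec_def\<close>)
  qed
  moreover have "snd p \<le> Y *v m"
    unfolding less_eq_vec_def
  proof
    fix i
    show "snd p $ i \<le> (Y *v m) $ i"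
      by (rule LIMSEQ_le[OF tendsto_vec_nth[OF tendsto_snd[OF ur]]
            tendsto_vec_nth[OF tendsto_matrix_vector_mult[OF lr]]])
        (use l(2) in \<open>auto simp: less_eq_vec_def\<close>)
  qed
  ultimately show "p \<in> technology X Y"
    using m by (auto simp: technology_def case_prod_beta)
qed

text \<open>If weights \<open>l\<close> of strongly efficient units converge to \<open>m\<close>, then eventually \<open>l\<close> is positive
  wherever \<open>m\<close> is. A direction \<open>k - m\<close> that improves the limit can then also be followed from \<open>l\<close>
  for a short while.\<close>

lemma closed_strongly_efficient: "closed (strongly_efficient (technology X Y))"
  unfolding closed_sequential_limits
proof (intro allI impI, elim conjE)
  fix u p
  assume u: "\<forall>n. u n \<in> strongly_efficient (technology X Y)" and lim: "u \<longlonglongrightarrow> p"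
  have "\<forall>n. \<exists>l. 0 \<le> l \<and> (\<Sum>j\<in>UNIV. l $ j) = 1 \<and> u n = (X *v l, Y *v l)"
    using u by (auto elim!: strongly_efficient_imp_combination)
  from choice[OF this] obtain l where "\<forall>n. 0 \<le> l n \<and> (\<Sum>j\<in>UNIV. l n $ j) = 1
      \<and> u n = (X *v l n, Y *v l n)"
    by (rule exE)
  then have l: "0 \<le> l n" "(\<Sum>j\<in>UNIV. l n $ j) = 1" "u n = (X *v l n, Y *v l n)" for n
    by simp_all
  obtain m r where m: "0 \<le> m" "(\<Sum>j\<in>UNIV. m $ j) = 1"
    and r: "strict_mono (r :: nat \<Rightarrow> nat)" and lr: "(\<lambda>n. l (r n)) \<longlonglongrightarrow> m"
    using weights_convergent_subsequence[OF l(1,2)] .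
  have "(\<lambda>n. u (r n)) \<longlonglongrightarrow> p"
    using LIMSEQ_subseq_LIMSEQ[OF lim r] by (simp add: o_def)
  moreover have "(\<lambda>n. u (r n)) \<longlonglongrightarrow> (X *v m, Y *v m)"
    unfolding l(3) by (intro tendsto_Pair tendsto_matrix_vector_mult lr)
  ultimately have p: "p = (X *v m, Y *v m)"
    by (rule LIMSEQ_unique)
  have "\<not> dominates v p" if v: "v \<in> technology X Y" for v
  proof
    assume dom: "dominates v p"
    obtain k where k: "X *v k \<le> fst v" "snd v \<le> Y *v k" "0 \<le> k" "(\<Sum>j\<in>UNIV. k $ j) = 1"
      using v by (auto simp: technology_def)
    have kx: "X *v k \<le> X *v m" and ky: "Y *v m \<le> Y *v k"
      using dom k p by (auto simp: dominates_def)
    \<comment> \<open>Equality in both parts would squeeze \<open>v\<close> between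
      \<open>(X *v k, Y *v k)\<close> and \<open>p\<close>, hence give \<open>v = p\<close>.\<close>
    have kne: "X *v k \<noteq> X *v m \<or> Y *v k \<noteq> Y *v m"
      using dom k p by (auto simp: dominates_def prod_eq_iff)
    have "\<forall>\<^sub>F n in sequentially. \<forall>j. 0 < m $ j \<longrightarrow> 0 < l (r n) $ j"
    proof (intro eventually_all_finite)
      fix j
      show "\<forall>\<^sub>F n in sequentially. 0 < m $ j \<longrightarrow> 0 < l (r n) $ j"
        using order_tendstoD(1)[OF tendsto_vec_nth[OF lr], of 0 j]
        by (cases "0 < m $ j") auto
    qed
    then obtain n where n: "\<And>j. 0 < m $ j \<Longrightarrow> 0 < l (r n) $ j"
      by (auto simp: eventually_sequentially)
    define a where "a = l (r n)"
    have a: "0 \<le> a" "(\<Sum>j\<in>UNIV. a $ j) = 1" "(X *v a, Y *v a) \<in> strongly_efficient (technology X Y)"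
      using l[of "r n"] u[rule_format, of "r n"] by (auto simp: a_def)
    have "\<forall>\<^sub>F e in at_right (0::real). \<forall>j. 0 \<le> a $ j + e * (k $ j - m $ j)"
    proof (intro eventually_all_finite)
      fix j
      show "\<forall>\<^sub>F e in at_right (0::real). 0 \<le> a $ j + e * (k $ j - m $ j)"
      proof (cases "0 < m $ j")
        case True
        have "((\<lambda>e. a $ j + e * (k $ j - m $ j)) \<longlongrightarrow> a $ j + 0 * (k $ j - m $ j)) (at_right 0)"
          by (intro tendsto_intros)
        from order_tendstoD(1)[OF this, of 0] show ?thesis
          using n[OF True] by (auto simp: a_def elim: eventually_mono)
      next
        case False
        \<comment> \<open>Where \<open>m\<close> vanishes, the direction \<open>k - m\<close> has a
          nonnegative coordinate, so moving along it cannot make the weight negative.\<close>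
        then have "m $ j = 0" "0 \<le> k $ j" "0 \<le> a $ j"
          using m k a by (auto simp: less_eq_vec_def intro: order_antisym)
        then show ?thesis
          by (auto intro!: eventually_at_right_less[THEN eventually_mono])
      qed
    qed
    then have "\<forall>\<^sub>F e in at_right (0::real). 0 < e \<and> (\<forall>j. 0 \<le> a $ j + e * (k $ j - m $ j))"
      by (simp add: eventually_conj_iff eventually_at_right_less)
    then obtain e :: real where e: "0 < e" "\<And>j. 0 \<le> a $ j + e * (k $ j - m $ j)"
      using eventually_happens'[OF trivial_limit_at_right_real] by blast
    \<comment> \<open>The coordinates of \<open>k - m\<close> sum to zero, so \<open>b\<close> is
      again a weight vector. By linearity its unit improves on that of \<open>a\<close> by
      \<open>e\<close> times the improvement from \<open>m\<close> to \<open>k\<close>.\<close>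
    define b where "b = a + e *\<^sub>R (k - m)"
    have b: "0 \<le> b" "(\<Sum>j\<in>UNIV. b $ j) = 1"
      using e a k m by (auto simp: b_def less_eq_vec_def sum.distrib
          sum_subtractf sum_distrib_left[symmetric])
    have Xb: "X *v b = X *v a + e *\<^sub>R (X *v k - X *v m)"
      and Yb: "Y *v b = Y *v a + e *\<^sub>R (Y *v k - Y *v m)"
      by (simp_all add: b_def matrix_vector_right_distrib matrix_vector_mult_scaleR
          matrix_vector_mult_diff_distrib)
    have "(X *v b, Y *v b) \<in> technology X Y"
      using b by (auto simp: technology_def)
    moreover have "dominates (X *v b, Y *v b) (X *v a, Y *v a)"
      using kx ky kne e(1)
      by (auto simp: dominates_def Xb Yb less_eq_vec_def mult_le_0_iff)
    ultimately show False
      using a(3) by (auto simp: strongly_efficient_def)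
  qed
  moreover have "p \<in> technology X Y"
    using m p by (auto simp: technology_def)
  ultimately show "p \<in> strongly_efficient (technology X Y)"
    by (auto simp: strongly_efficient_def)
qed

section \<open>Moving from a point towards the ideal point\<close>

lemma strictly_dominated_imp_step:
  assumes v: "v \<in> technology X Y" "strictly_dominates v u"
  obtains e :: real where "0 < e" "e < 1" "u + e *\<^sub>R (w - u) \<in> technology X Y"
proof -
  \<comment> \<open>Strict domination is an open condition, so it survives a short step from
    \<open>u\<close> towards any \<open>w\<close>; free disposal then makes the shifted point a
    unit.\<close>
  have "\<forall>\<^sub>F e in at_right (0::real). \<forall>i. fst v $ i < fst (u + e *\<^sub>R (w - u)) $ i"
  proof (intro eventually_all_finite)
    fix i
    have "((\<lambda>e. fst (u + e *\<^sub>R (w - u)) $ i) \<longlongrightarrow> fst (u + 0 *\<^sub>R (w - u)) $ i) (at_right 0)"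
      by (intro tendsto_intros)
    from order_tendstoD(1)[OF this]
    show "\<forall>\<^sub>F e in at_right (0::real). fst v $ i < fst (u + e *\<^sub>R (w - u)) $ i"
      using v(2) by (auto simp: strictly_dominates_def)
  qed
  moreover have "\<forall>\<^sub>F e in at_right (0::real). \<forall>i. snd (u + e *\<^sub>R (w - u)) $ i < snd v $ i"
  proof (intro eventually_all_finite)
    fix i
    have "((\<lambda>e. snd (u + e *\<^sub>R (w - u)) $ i) \<longlongrightarrow> snd (u + 0 *\<^sub>R (w - u)) $ i) (at_right 0)"
      by (intro tendsto_intros)
    from order_tendstoD(2)[OF this]
    show "\<forall>\<^sub>F e in at_right (0::real). snd (u + e *\<^sub>R (w - u)) $ i < snd v $ i"
      using v(2) by (auto simp: strictly_dominates_def)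
  qed
  moreover have "\<forall>\<^sub>F e in at_right (0::real). e \<in> {0<..<1}"
    by (rule eventually_at_right_real) simp
  ultimately have "\<forall>\<^sub>F e in at_right (0::real). 0 < e \<and> e < 1 \<and> u + e *\<^sub>R (w - u) \<in> technology X Y"
  proof eventually_elim
    case (elim e)
    then show ?case
      by (intro conjI technology_free_disposal[OF v(1)])
        (auto simp: less_eq_vec_def intro: less_imp_le)
  qed
  then show ?thesis
    using that eventually_happens'[OF trivial_limit_at_right_real] by blast
qed

text \<open>The parameters at which the segment meets the technology form a compact set. Its maximum
  is below \<open>1\<close> because the ideal point is not a unit, and strict domination at that
  point would permit a further step.\<close>

lemma segment_to_ideal_exit:
  assumes q: "q \<in> technology X Y" and I: "ideal_point X Y \<notin> technology X Y"
  obtains s :: real where "0 \<le> s" "s < 1"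
    "q + s *\<^sub>R (ideal_point X Y - q) \<in> weakly_efficient (technology X Y)"
proof -
  let ?I = "ideal_point X Y" and ?T = "technology X Y"
  define S where "S = {s \<in> {0..1::real}. q + s *\<^sub>R (?I - q) \<in> ?T}"
  have "S = {0..1} \<inter> (\<lambda>s. q + s *\<^sub>R (?I - q)) -` ?T"
    by (auto simp: S_def)
  moreover have "closed ((\<lambda>s. q + s *\<^sub>R (?I - q)) -` ?T)"
    by (intro continuous_closed_vimage closed_technology continuous_intros)
  ultimately have "compact S"
    by (simp add: compact_Int_closed)
  moreover have "0 \<in> S" using q by (simp add: S_def)
  ultimately obtain s where s: "s \<in> S" "\<And>t. t \<in> S \<Longrightarrow> t \<le> s"
    using compact_attains_sup[of S] by blast
  let ?p = "q + s *\<^sub>R (?I - q)"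
  have "s \<noteq> 1" using s(1) I by (auto simp: S_def)
  then have s1: "0 \<le> s" "s < 1" "?p \<in> ?T" using s(1) by (auto simp: S_def)
  have "\<not> strictly_dominates v ?p" if v: "v \<in> ?T" for v
  proof
    assume "strictly_dominates v ?p"
    from strictly_dominated_imp_step[OF v this, of ?I]
    obtain e where e: "0 < e" "e < 1" "?p + e *\<^sub>R (?I - ?p) \<in> ?T" .
    \<comment> \<open>Going the fraction \<open>e\<close> of the remaining way to the ideal point
      means going to this parameter on the original segment.\<close>
    let ?t = "s + e * (1 - s)"
    have eq: "?p + e *\<^sub>R (?I - ?p) = q + ?t *\<^sub>R (?I - q)"
      by (simp add: algebra_simps)
    have "e * (1 - s) \<le> 1 * (1 - s)"
      using e s1 by (intro mult_right_mono) auto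
    moreover have pos: "0 < e * (1 - s)"
      using e s1 by simp
    ultimately have "?t \<in> {0..1}"
      using s1(1) by simp
    with e(3) have "?t \<in> S"
      unfolding S_def eq by blast
    with s(2)[of ?t] pos show False by simp
  qed
  with s1 that show ?thesis
    by (auto simp: weakly_efficient_def)
qed

text \<open>A limit of the exit points of the worsened segments is strongly efficient by closedness.
  It lies on the segment from \<open>p\<close> to the ideal point, where \<open>maxp\<close> leaves
  only \<open>p\<close>.\<close>

lemma ideal_technology_segment_start_strongly_efficient:
  assumes ideal: "ideal_technology X Y" and p: "p \<in> technology X Y"
    and maxp: "\<And>s. 0 < s \<Longrightarrow> s \<le> 1 \<Longrightarrow> p + s *\<^sub>R (ideal_point X Y - p) \<notin> technology X Y"
  shows "p \<in> strongly_efficient (technology X Y)"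
proof -
  let ?I = "ideal_point X Y" and ?T = "technology X Y"
  have I: "?I \<notin> ?T" using maxp[of 1] by simp
  \<comment> \<open>Inputs rise and outputs fall, so free disposal applies. \<open>Suc n\<close>
    keeps the worsening positive at \<open>n = 0\<close> as well, where \<open>inverse 0\<close>
    would be \<open>0\<close>.\<close>
  define q where "q n = p + inverse (real (Suc n)) *\<^sub>R ((\<chi> i. 1, \<chi> r. -1))" for n
  have q: "q n \<in> ?T" for n
    by (rule technology_free_disposal[OF p]) (auto simp: q_def less_eq_vec_def)
  have "\<forall>n. \<exists>s. 0 \<le> s \<and> s < 1 \<and> q n + s *\<^sub>R (?I - q n) \<in> weakly_efficient ?T"
    using segment_to_ideal_exit[OF q I] by metis
  from choice[OF this] obtain s where
    "\<forall>n. 0 \<le> s n \<and> s n < 1 \<and> q n + s n *\<^sub>R (?I - q n) \<in> weakly_efficient ?T"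
    by (rule exE)
  then have s: "0 \<le> s n" "s n < 1" "q n + s n *\<^sub>R (?I - q n) \<in> weakly_efficient ?T" for n
    by simp_all
  have se: "q n + s n *\<^sub>R (?I - q n) \<in> strongly_efficient ?T" for n
  proof -
    have x: "fst (q n + s n *\<^sub>R (?I - q n)) $ i \<noteq> fst ?I $ i" for i
    proof -
      have "fst ?I $ i < fst (q n) $ i"
        using technology_ideal_bounds(1)[OF p]
        by (simp add: q_def less_eq_vec_def add_increasing2 le_less_trans[of _ "fst p $ i"])
      \<comment> \<open>Moving towards the ideal point scales the gap in each component by
        \<open>1 - s n\<close>; stopping before the ideal point leaves it positive.\<close>
      then have "0 < (1 - s n) * (fst (q n) $ i - fst ?I $ i)"
        using s(2)[of n] by simp
      then show ?thesis by (simp add: algebra_simps)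
    qed
    have y: "snd (q n + s n *\<^sub>R (?I - q n)) $ i \<noteq> snd ?I $ i" for i
    proof -
      have "snd (q n) $ i < snd ?I $ i"
        using technology_ideal_bounds(2)[OF p]
        by (simp add: q_def less_eq_vec_def less_le_trans[of _ "snd p $ i"])
      then have "0 < (1 - s n) * (snd ?I $ i - snd (q n) $ i)"
        using s(2)[of n] by simp
      then show ?thesis by (simp add: algebra_simps)
    qed
    show ?thesis
      using ideal s(3)[of n] x y unfolding ideal_technology_def by blast
  qed
  \<comment> \<open>The limit of the parameters may a priori be \<open>1\<close>;
    \<open>maxp\<close> rules out every nonzero limit below.\<close>
  have s01: "\<forall>n. s n \<in> {0..1}" using s(1,2) by (simp add: less_imp_le)
  obtain s0 r where s0: "s0 \<in> {0..1}" and r: "strict_mono (r :: nat \<Rightarrow> nat)"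
    and sr: "(\<lambda>n. s (r n)) \<longlonglongrightarrow> s0"
    using compact_Icc[of 0 "1::real", unfolded compact_def, THEN spec, THEN mp, OF s01] unfolding o_def by blast
  have "q \<longlonglongrightarrow> p + 0 *\<^sub>R ((\<chi> i. 1, \<chi> r. -1))"
    unfolding q_def by (intro tendsto_intros LIMSEQ_inverse_real_of_nat)
  then have "q \<longlonglongrightarrow> p" by (simp add: zero_prod_def[symmetric])
  then have qr: "(\<lambda>n. q (r n)) \<longlonglongrightarrow> p"
    using LIMSEQ_subseq_LIMSEQ[OF _ r, of q] by (simp add: o_def)
  have "(\<lambda>n. q (r n) + s (r n) *\<^sub>R (?I - q (r n))) \<longlonglongrightarrow> p + s0 *\<^sub>R (?I - p)"
    by (intro tendsto_intros qr sr)
  then have lim: "p + s0 *\<^sub>R (?I - p) \<in> strongly_efficient ?T"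
    by (rule closed_sequentially[OF closed_strongly_efficient se])
  then have "s0 = 0"
    using maxp[of s0] s0 by (cases "s0 = 0") (auto simp: strongly_efficient_def)
  with lim show ?thesis by simp
qed

section \<open>The GS score and the path for range directions\<close>

lemma gs_feasible_iff_technology:
  "(\<exists>l. gs_feasible X Y \<psi>x \<psi>y D g u l \<theta>)
     \<longleftrightarrow> \<theta> \<in> D \<and> gs_path \<psi>x \<psi>y g u \<theta> \<in> technology X Y"
  by (auto simp: gs_feasible_def technology_def case_prod_beta)

text \<open>\<open>LEAST\<close> says nothing until a minimum is known to exist. Attainment
  identifies it with that minimum, and the weights are eliminated so that only membership of path
  points remains.\<close>

lemma range_score_properties:
  fixes X :: "real^'n^'m" and Y :: "real^'n^'s"
  assumes cont: "continuous_on (ray ax) \<psi>x" "continuous_on (ray ay) \<psi>y"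
    and mono: "strict_mono_on (ray ax) \<psi>x" "strict_antimono_on (ray ay) \<psi>y"
    and one: "\<psi>x 1 = 1" "\<psi>y 1 = 1"
    and \<theta>min: "\<theta>min \<in> {0..<1} \<inter> (ray ax \<inter> ray ay)"
    and u: "u \<in> technology X Y" "u \<noteq> ideal_point X Y"
  defines "D \<equiv> ray ax \<inter> ray ay"
  defines "\<theta> \<equiv> range_score X Y \<psi>x \<psi>y D \<theta>min u"
    and "\<phi> \<equiv> gs_path \<psi>x \<psi>y (range_direction X Y \<psi>x \<psi>y \<theta>min u) u"
  shows "\<theta>min \<le> \<theta>" "\<theta> \<le> 1" "\<phi> \<theta> \<in> technology X Y"
    "\<And>t. t \<in> D \<Longrightarrow> \<phi> t \<in> technology X Y \<Longrightarrow> \<theta> \<le> t"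
proof -
  let ?P = "\<lambda>t. t \<in> D \<and> \<phi> t \<in> technology X Y"
  obtain t where t: "\<theta>min \<le> t" "t \<le> 1" "?P t" "\<And>t'. ?P t' \<Longrightarrow> t \<le> t'"
    using range_minimum_attained[OF cont mono one \<theta>min u]
    unfolding D_def \<phi>_def atLeastAtMost_iff Bex_def gs_feasible_iff_technology[symmetric] by blast
  have "\<theta> = (LEAST t. ?P t)"
    using u(2) by (simp add: \<theta>_def range_score_def gs_value_def gs_feasible_iff_technology \<phi>_def)
  also have "\<dots> = t"
    by (rule Least_equality) (use t in auto)
  finally show "\<theta>min \<le> \<theta>" "\<theta> \<le> 1" "\<phi> \<theta> \<in> technology X Y"
    "\<And>t. t \<in> D \<Longrightarrow> \<phi> t \<in> technology X Y \<Longrightarrow> \<theta> \<le> t"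
    using t by auto
qed

theorem theorem4p9:
  fixes X :: "real^'n^'m" and Y :: "real^'n^'s"
    and \<psi>x \<psi>y :: "real \<Rightarrow> real"
    and ax ay bx by' :: ereal and \<theta>min :: real
  assumes A1: "ax \<in> {-\<infinity>, 0}" "ay \<in> {-\<infinity>, 0}"
    and A2x: "\<psi>x C1_differentiable_on ray ax" "concave_on (ray ax) \<psi>x" "strict_mono_on (ray ax) \<psi>x"
    and A2y: "\<psi>y C1_differentiable_on ray ay" "convex_on (ray ay) \<psi>y" "strict_antimono_on (ray ay) \<psi>y"
    and A3: "\<psi>x 1 = 1" "\<psi>y 1 = 1"
    and A4x: "bx \<in> {-\<infinity>, 0}" "\<psi>x ` ray ax = ray bx"
      "(\<forall>u \<in> technology X Y. snd (range_direction X Y \<psi>x \<psi>y \<theta>min u) = 0) \<longrightarrow> bx = -\<infinity>"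
    and A4y: "by' \<in> {-\<infinity>, 0}" "\<psi>y ` ray ay = ray by'"
    and \<theta>min: "\<theta>min \<in> {0..<1} \<inter> (ray ax \<inter> ray ay)"
  shows "(\<forall>u \<in> technology X Y.
            range_projection X Y \<psi>x \<psi>y (ray ax \<inter> ray ay) \<theta>min u
              \<in> strongly_efficient (technology X Y))
         \<longleftrightarrow> ideal_technology X Y"
proof -
  let ?I = "ideal_point X Y" and ?T = "technology X Y"
  let ?path = "\<lambda>u. gs_path \<psi>x \<psi>y (range_direction X Y \<psi>x \<psi>y \<theta>min u) u"
  let ?sc = "range_score X Y \<psi>x \<psi>y (ray ax \<inter> ray ay) \<theta>min"
  let ?proj = "range_projection X Y \<psi>x \<psi>y (ray ax \<inter> ray ay) \<theta>min"
  have proj: "?proj u = ?path u (?sc u)" for u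
    by (simp add: range_projection_def)
  have cont: "continuous_on (ray ax) \<psi>x" "continuous_on (ray ay) \<psi>y"
    using A2x(1) A2y(1) by (auto intro: C1_differentiable_imp_continuous_on)
  note score = range_score_properties[OF cont A2x(3) A2y(3) A3 \<theta>min]
  have ray: "t \<in> ray ax" "t \<in> ray ay" if "\<theta>min \<le> t" for t
  proof -
    have "ereal \<theta>min \<le> ereal t" using that by simp
    then show "t \<in> ray ax" "t \<in> ray ay"
      using \<theta>min unfolding ray_def by (auto intro: less_le_trans)
  qed
  have mx: "\<psi>x t < \<psi>x t'" and my: "\<psi>y t' < \<psi>y t" if "\<theta>min \<le> t" "t < t'" for t t'
    using strict_mono_onD[OF A2x(3), of t t'] monotone_onD[OF A2y(3), of t t'] ray that by auto
  have dx: "0 < 1 - \<psi>x \<theta>min" and dy: "0 < \<psi>y \<theta>min - 1"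
    using mx[of \<theta>min 1] my[of \<theta>min 1] \<theta>min A3 by auto
  \<comment> \<open>Affine rescalings of \<open>\<psi>x\<close> and \<open>\<psi>y\<close>, both
    increasing from \<open>\<theta>min\<close> on and normalised to \<open>0\<close> at
    \<open>\<theta>min\<close> and \<open>1\<close> at \<open>1\<close>.\<close>
  define kx where "kx t = (\<psi>x t - \<psi>x \<theta>min) / (1 - \<psi>x \<theta>min)" for t
  define ky where "ky t = (\<psi>y \<theta>min - \<psi>y t) / (\<psi>y \<theta>min - 1)" for t
  have k_mono: "kx t < kx t'" "ky t < ky t'" if "\<theta>min \<le> t" "t < t'" for t t'
    using mx[OF that] my[OF that] dx dy by (auto simp: kx_def ky_def divide_strict_right_mono)
  have k_min: "kx \<theta>min = 0" "ky \<theta>min = 0" and k_one: "kx 1 = 1" "ky 1 = 1"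
    using dx dy A3 by (auto simp: kx_def ky_def)
  \<comment> \<open>Both parts of the path interpolate between the unit, at \<open>1\<close>, and the ideal point, at \<open>\<theta>min\<close>,
    but in general with different weights.\<close>
  have path: "fst (?path u t) = fst ?I + kx t *\<^sub>R (fst u - fst ?I)"
    "snd (?path u t) = snd ?I + ky t *\<^sub>R (snd u - snd ?I)" for u t
  proof -
    have "(\<psi>x t - 1) * (1 / (1 - \<psi>x \<theta>min)) = kx t - 1"
      "(\<psi>y t - 1) * (1 / (\<psi>y \<theta>min - 1)) = 1 - ky t"
      using dx dy by (auto simp: kx_def ky_def field_simps)
    then have "fst (?path u t) = fst u + (kx t - 1) *\<^sub>R (fst u - fst ?I)"
      "snd (?path u t) = snd u + (1 - ky t) *\<^sub>R (snd ?I - snd u)"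
      by (simp_all only: gs_path_def range_direction_def fst_conv snd_conv scaleR_scaleR)
    then show "fst (?path u t) = fst ?I + kx t *\<^sub>R (fst u - fst ?I)"
      "snd (?path u t) = snd ?I + ky t *\<^sub>R (snd u - snd ?I)"
      by (simp_all add: algebra_simps)
  qed
  have path_one: "?path u 1 = u" for u
    by (rule prod_eqI) (simp_all add: path k_one)
  show ?thesis
  proof (intro iffI ballI)

    \<comment> \<open>Strongly efficient projections force an ideal technology\<close>
    assume se: "\<forall>u\<in>?T. ?proj u \<in> strongly_efficient ?T"
    show "ideal_technology X Y"
      unfolding ideal_technology_def
    proof (rule ballI, rule ccontr)
      fix u
      assume u: "u \<in> weakly_efficient ?T - strongly_efficient ?T"
        and "\<not> ((\<exists>i. fst u $ i = fst ?I $ i) \<or> (\<exists>r. snd u $ r = snd ?I $ r))"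
      then have ne: "fst u $ i \<noteq> fst ?I $ i" "snd u $ r \<noteq> snd ?I $ r" for i r by auto
      have uT: "u \<in> ?T" using u by (simp add: weakly_efficient_def)
      have uI: "u \<noteq> ?I" using ne by auto
      note sc = score[OF uT uI]
      have lx: "fst ?I $ i < fst u $ i" and ly: "snd u $ r < snd ?I $ r" for i r
        using technology_ideal_bounds[OF uT] ne(1)[of i] ne(2)[of r] unfolding less_eq_vec_def
        by (metis order_less_le)+
      \<comment> \<open>All gaps to the ideal point are positive, so a score below \<open>1\<close>
        would yield a path point in the technology that strictly dominates \<open>u\<close>.\<close>
      have "?sc u = 1"
      proof (rule ccontr)
        assume "?sc u \<noteq> 1"
        then have "?sc u < 1" using sc(2) by simp
        then have k: "kx (?sc u) < 1" "ky (?sc u) < 1"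
          using k_mono[OF sc(1)] k_one by metis+
        have "strictly_dominates (?path u (?sc u)) u"
          unfolding strictly_dominates_def path
        proof (intro conjI allI)
          fix i
          have "0 < (1 - kx (?sc u)) * (fst u $ i - fst ?I $ i)"
            using k lx[of i] by simp
          then show "(fst ?I + kx (?sc u) *\<^sub>R (fst u - fst ?I)) $ i < fst u $ i"
            by (simp add: algebra_simps)
        next
          fix r
          have "0 < (1 - ky (?sc u)) * (snd ?I $ r - snd u $ r)"
            using k ly[of r] by simp
          then show "snd u $ r < (snd ?I + ky (?sc u) *\<^sub>R (snd u - snd ?I)) $ r"
            by (simp add: algebra_simps)
        qed
        with sc(3) u show False by (auto simp: weakly_efficient_def)
      qed
      then have "?proj u = u"
        by (simp add: proj path_one)
      with se uT u show False by auto
    qed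
  next

    \<comment> \<open>An ideal technology makes all projections strongly efficient\<close>
    fix u
    assume ideal: "ideal_technology X Y" and uT: "u \<in> ?T"
    show "?proj u \<in> strongly_efficient ?T"
    proof (cases "u = ?I")
      case True
      then have "?proj u = ?I"
        by (simp add: proj range_score_def path_one)
      with uT True show ?thesis
        using ideal_point_strongly_efficient by metis
    next
      case False
      note sc = score[OF uT False]
      show ?thesis
      proof (cases "?sc u = \<theta>min")
        case True
        \<comment> \<open>At \<open>\<theta>min\<close> the path has arrived at the ideal point,
          which is then a unit.\<close>
        then have "?proj u = ?I"
          by (intro prod_eqI) (simp_all add: proj path k_min)
        with sc(3) show ?thesis
          using ideal_point_strongly_efficient proj by metis
      next
        case neq: False
        define \<theta> where "\<theta> = ?sc u"
        define p where "p = ?path u \<theta>"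
        have \<theta>: "\<theta>min < \<theta>" "p \<in> ?T" "\<And>t. \<theta>min \<le> t \<Longrightarrow> ?path u t \<in> ?T \<Longrightarrow> \<theta> \<le> t"
          using sc neq ray by (auto simp: \<theta>_def p_def)
        have k_pos: "0 < kx \<theta>" "0 < ky \<theta>"
          using k_mono[OF order_refl \<theta>(1)] k_min by auto
        \<comment> \<open>The path need not follow the segment, since \<open>kx\<close> and
          \<open>ky\<close> may differ. But their values at \<open>\<theta>\<close> are positive, so
          by continuity both exceed \<open>1 - s\<close> times these values at some \<open>t\<close>
          just below \<open>\<theta>\<close>. The path point at \<open>t\<close> is then no better
          than the segment point in any component, so it would be a unit as well, against the
          minimality of \<open>\<theta>\<close>.\<close>
        have "p + s *\<^sub>R (?I - p) \<notin> ?T" if s: "0 < s" "s \<le> 1" for s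
        proof
          assume T: "p + s *\<^sub>R (?I - p) \<in> ?T"
          have "isCont \<psi>x \<theta>" "isCont \<psi>y \<theta>"
          proof -
            have "\<theta> \<in> {\<theta>min<..}" "{\<theta>min<..} \<subseteq> ray ax" "{\<theta>min<..} \<subseteq> ray ay"
              using \<theta>(1) ray by auto
            then show "isCont \<psi>x \<theta>" "isCont \<psi>y \<theta>"
              using cont[THEN continuous_on_subset]
              by (meson continuous_on_eq_continuous_at open_greaterThan)+
          qed
          then have "isCont kx \<theta>" "isCont ky \<theta>"
            unfolding kx_def ky_def using dx dy by (auto intro!: continuous_intros)
          then have lim: "(kx \<longlongrightarrow> kx \<theta>) (at_left \<theta>)" "(ky \<longlongrightarrow> ky \<theta>) (at_left \<theta>)"
            by (auto simp: isCont_def intro: tendsto_mono at_le)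
          have "\<forall>\<^sub>F t in at_left \<theta>. (1 - s) * kx \<theta> < kx t"
            "\<forall>\<^sub>F t in at_left \<theta>. (1 - s) * ky \<theta> < ky t"
            by (rule order_tendstoD(1)[OF lim(1)] order_tendstoD(1)[OF lim(2)];
                use k_pos s in \<open>simp add: algebra_simps\<close>)+
          moreover have "\<forall>\<^sub>F t in at_left \<theta>. t \<in> {\<theta>min<..<\<theta>}"
            by (rule eventually_at_left_real[OF \<theta>(1)])
          ultimately have "\<forall>\<^sub>F t in at_left \<theta>. (1 - s) * kx \<theta> < kx t \<and> (1 - s) * ky \<theta> < ky t
              \<and> t \<in> {\<theta>min<..<\<theta>}"
            by eventually_elim auto
          then obtain t where t: "(1 - s) * kx \<theta> < kx t" "(1 - s) * ky \<theta> < ky t" "\<theta>min < t" "t < \<theta>"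
            using eventually_happens'[OF trivial_limit_at_left_real] by auto
          have "?path u t \<in> ?T"
          proof (rule technology_free_disposal[OF T])
            have "fst (p + s *\<^sub>R (?I - p)) = fst ?I + ((1 - s) * kx \<theta>) *\<^sub>R (fst u - fst ?I)"
              by (simp add: p_def path algebra_simps)
            also have "\<dots> \<le> fst (?path u t)"
              using t(1) technology_ideal_bounds(1)[OF uT]
              by (auto simp: path less_eq_vec_def intro: mult_right_mono)
            finally show "fst (p + s *\<^sub>R (?I - p)) \<le> fst (?path u t)" .
            have "snd (?path u t) \<le> snd ?I + ((1 - s) * ky \<theta>) *\<^sub>R (snd u - snd ?I)"
              using t(2) technology_ideal_bounds(2)[OF uT]
              by (auto simp: path less_eq_vec_def intro: mult_right_mono_neg)
            also have "\<dots> = snd (p + s *\<^sub>R (?I - p))"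
              by (simp add: p_def path algebra_simps)
            finally show "snd (?path u t) \<le> snd (p + s *\<^sub>R (?I - p))" .
          qed
          with \<theta>(3)[of t] t show False by simp
        qed
        then have "p \<in> strongly_efficient ?T"
          by (rule ideal_technology_segment_start_strongly_efficient[OF ideal \<theta>(2)])
        then show ?thesis by (simp add: proj p_def \<theta>_def)
      qed
    qed
  qed
qed

end
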